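(* Let $\mathbb F$ be a field, $\mathcal M$ the multiset monad over $\mathbb F$, $\mathcal A$ a set, $F=\mathcal A\times(\cdot)+1$ ($1=\{\bullet\}$), and let $\alpha:X\to\mathcal M(\mathcal A\times X+1)$ be a linear weighted automaton, viewed as a $\bar F$-coalgebra in $\mathbf{Kl}(\mathcal M)$. Let $\simeq_X\subseteq\mathcal MX\times\mathcal MX$ be weighted language equivalence on the determinised system. Then $\simeq_X\subseteq(|\alpha|\times|\alpha|)^{-1}(\bar\lambda_X(\simeq_X))$. Moreover, $\simeq_X=(|f|\times|f|)^{-1}(\simeq_Y)$ for every coalgebra homomorphism $f:(X,\alpha)\to(Y,\beta)$ in $\mathbf{Kl}(\mathcal M)$; consequently, sending each coalgebra $(X,\alpha)$ to the greatest relation $R\subseteq\mathcal MX\times\mathcal MX$ with $R\subseteq(|\alpha|\times|\alpha|)^{-1}(\bar\lambda_XR)$, and each homomorphism to itself, defines a functor (the behavioural conformance functor).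
   Context: $\mathcal MX$ is the set of finitely supported functions $X\to\mathbb F$, $\mathcal Mf(\tau)(y)=\sum_{x\in f^{-1}(y)}\tau(x)$. In $\mathbf{Kl}(\mathcal M)$, $|X|=\mathcal MX$ and for $f:X\to\mathcal MY$, $|f|(p)=\sum_xp(x)\cdot f(x)$. The distributive law $\vartheta_X:F\mathcal MX\to\mathcal MFX$ is $\vartheta_X(\bullet)=\delta_\bullet$ and $\vartheta_X(a,\tau)(a,x)=\tau(x)$ (zero elsewhere); $\bar Ff=\vartheta_Y\circ Ff$, and a homomorphism satisfies $\bar Ff\circ\alpha=\beta\circ f$ in $\mathbf{Kl}(\mathcal M)$. Determinisation: for $p\in\mathcal MX$, $p_a(x')=\sum_xp(x)\alpha(x)(a,x')$, $p_\varepsilon=p$, $p_{aw}=(p_a)_w$, and $o(p)=\sum_xp(x)\alpha(x)(\bullet)$. Weighted language equivalence: $p\simeq_Xp'$ iff $o(p_w)=o(p'_w)$ for all $w\in\mathcal A^*$. For $R\subseteq\mathcal MX\times\mathcal MX$, $\bar\lambda_X(R)\subseteq\mathcal M(FX)\times\mathcal M(FX)$: $\bar p\mathrel{\bar\lambda_XR}\bar p'$ iff $\bar p(\bullet)=\bar p'(\bullet)$ and for all $a\in\mathcal A$, $\gamma^{\mathcal A}\bar p(a)\mathrel R\gamma^{\mathcal A}\bar p'(a)$, where $\gamma^{\mathcal A}\bar p(a)(x)=\bar p(a,x)$. A morphism of the target category $((X,\alpha),R)\to((Y,\beta),S)$ is a homomorphism $f$ with $R\subseteq(|f|\times|f|)^{-1}S$.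 *)

theory Defs
  imports Main "HOL-Library.FuncSet"
begin

text \<open>
  Sets are represented by carrier subsets of a type, so that empty state sets and
  empty alphabets are included.  Functions out of a carrier \<open>X\<close> are taken
  from \<open>X \<rightarrow>\<^sub>E _\<close>, so that equality of morphisms is equality of HOL functions.
\<close>

definition supp :: "('x \<Rightarrow> 'k::field) \<Rightarrow> 'x set" where
  "supp p = {x. p x \<noteq> 0}"

definition Mset :: "'x set \<Rightarrow> ('x \<Rightarrow> 'k::field) set" where
  "Mset X = {p. finite (supp p) \<and> supp p \<subseteq> X}"

definition dirac :: "'x \<Rightarrow> 'x \<Rightarrow> 'k::field" where
  "dirac x = (\<lambda>y. if y = x then 1 else 0)"

definition kl_hom :: "'x set \<Rightarrow> 'y set \<Rightarrow> ('x \<Rightarrow> 'y \<Rightarrow> 'k::field) set" where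
  "kl_hom X Y = X \<rightarrow>\<^sub>E Mset Y"

text \<open>The linear map \<open>|f| : \<M>X \<rightarrow> \<M>Y\<close>; only meaningful on arguments in \<open>\<M>X\<close>.\<close>

definition kl_ext :: "('x \<Rightarrow> 'y \<Rightarrow> 'k::field) \<Rightarrow> ('x \<Rightarrow> 'k) \<Rightarrow> ('y \<Rightarrow> 'k)" where
  "kl_ext f p = (\<lambda>y. \<Sum>x\<in>supp p. p x * f x y)"

definition kl_id :: "'x set \<Rightarrow> 'x \<Rightarrow> 'x \<Rightarrow> 'k::field" where
  "kl_id X = (\<lambda>x\<in>X. dirac x)"

definition kl_comp ::
  "'x set \<Rightarrow> ('y \<Rightarrow> 'z \<Rightarrow> 'k::field) \<Rightarrow> ('x \<Rightarrow> 'y \<Rightarrow> 'k) \<Rightarrow> ('x \<Rightarrow> 'z \<Rightarrow> 'k)" where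
  "kl_comp X g f = (\<lambda>x\<in>X. kl_ext g (f x))"

type_synonym ('a, 'x) F = "'a \<times> 'x + unit"

abbreviation bullet :: "('a, 'x) F" where
  "bullet \<equiv> Inr ()"

definition F_obj :: "'a set \<Rightarrow> 'x set \<Rightarrow> ('a, 'x) F set" where
  "F_obj A X = (A \<times> X) <+> {()}"

definition F_map :: "('x \<Rightarrow> 'y) \<Rightarrow> ('a, 'x) F \<Rightarrow> ('a, 'y) F" where
  "F_map f = map_sum (map_prod id f) id"

fun distr_law :: "('a, 'y \<Rightarrow> 'k::field) F \<Rightarrow> ('a, 'y) F \<Rightarrow> 'k" where
  "distr_law (Inr u) = dirac bullet"
| "distr_law (Inl (a, \<tau>)) =
     (\<lambda>z. case z of Inl (b, y) \<Rightarrow> (if b = a then \<tau> y else 0) | Inr _ \<Rightarrow> 0)"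

definition F_bar ::
  "'a set \<Rightarrow> 'x set \<Rightarrow> ('x \<Rightarrow> 'y \<Rightarrow> 'k::field) \<Rightarrow> (('a, 'x) F \<Rightarrow> ('a, 'y) F \<Rightarrow> 'k)" where
  "F_bar A X f = restrict (distr_law \<circ> F_map f) (F_obj A X)"

type_synonym ('a, 'x, 'k) wstruct = "'x \<Rightarrow> ('a, 'x) F \<Rightarrow> 'k"

definition coalgebra :: "'a set \<Rightarrow> 'x set \<Rightarrow> ('a, 'x, 'k::field) wstruct \<Rightarrow> bool" where
  "coalgebra A X \<alpha> \<longleftrightarrow> \<alpha> \<in> kl_hom X (F_obj A X)"

definition coalg_hom ::
  "'a set \<Rightarrow> 'x set \<Rightarrow> ('a, 'x, 'k::field) wstruct \<Rightarrow> 'y set \<Rightarrow> ('a, 'y, 'k) wstruct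
    \<Rightarrow> ('x \<Rightarrow> 'y \<Rightarrow> 'k) \<Rightarrow> bool" where
  "coalg_hom A X \<alpha> Y \<beta> f \<longleftrightarrow>
     f \<in> kl_hom X Y \<and> kl_comp X (F_bar A X f) \<alpha> = kl_comp X \<beta> f"

definition det_step :: "('a, 'x, 'k::field) wstruct \<Rightarrow> ('x \<Rightarrow> 'k) \<Rightarrow> 'a \<Rightarrow> ('x \<Rightarrow> 'k)" where
  "det_step \<alpha> p a = (\<lambda>x'. \<Sum>x\<in>supp p. p x * \<alpha> x (Inl (a, x')))"

fun det_word :: "('a, 'x, 'k::field) wstruct \<Rightarrow> ('x \<Rightarrow> 'k) \<Rightarrow> 'a list \<Rightarrow> ('x \<Rightarrow> 'k)" where
  "det_word \<alpha> p [] = p"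
| "det_word \<alpha> p (a # w) = det_word \<alpha> (det_step \<alpha> p a) w"

definition det_out :: "('a, 'x, 'k::field) wstruct \<Rightarrow> ('x \<Rightarrow> 'k) \<Rightarrow> 'k" where
  "det_out \<alpha> p = (\<Sum>x\<in>supp p. p x * \<alpha> x bullet)"

definition lang_equiv ::
  "'a set \<Rightarrow> 'x set \<Rightarrow> ('a, 'x, 'k::field) wstruct \<Rightarrow> ('x \<Rightarrow> 'k) rel" where
  "lang_equiv A X \<alpha> = {(p, p') \<in> Mset X \<times> Mset X.
     \<forall>w\<in>lists A. det_out \<alpha> (det_word \<alpha> p w) = det_out \<alpha> (det_word \<alpha> p' w)}"

definition gamma :: "(('a, 'x) F \<Rightarrow> 'k::field) \<Rightarrow> 'a \<Rightarrow> ('x \<Rightarrow> 'k)" where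
  "gamma q a = (\<lambda>x. q (Inl (a, x)))"

definition lambda_bar ::
  "'a set \<Rightarrow> 'x set \<Rightarrow> ('x \<Rightarrow> 'k::field) rel \<Rightarrow> (('a, 'x) F \<Rightarrow> 'k) rel" where
  "lambda_bar A X R = {(q, q') \<in> Mset (F_obj A X) \<times> Mset (F_obj A X).
     q bullet = q' bullet \<and> (\<forall>a\<in>A. (gamma q a, gamma q' a) \<in> R)}"

text \<open>The preimage of \<open>S\<close> under \<open>|f| \<times> |f|\<close>, where \<open>|f|\<close> has domain \<open>\<M>X\<close>.\<close>

definition reindex :: "'x set \<Rightarrow> ('x \<Rightarrow> 'y \<Rightarrow> 'k::field) \<Rightarrow> ('y \<Rightarrow> 'k) rel \<Rightarrow> ('x \<Rightarrow> 'k) rel" where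
  "reindex X f S = (map_prod (kl_ext f) (kl_ext f) -` S) \<inter> (Mset X \<times> Mset X)"

definition is_conformance ::
  "'a set \<Rightarrow> 'x set \<Rightarrow> ('a, 'x, 'k::field) wstruct \<Rightarrow> ('x \<Rightarrow> 'k) rel \<Rightarrow> bool" where
  "is_conformance A X \<alpha> R \<longleftrightarrow>
     R \<subseteq> Mset X \<times> Mset X \<and> R \<subseteq> reindex X \<alpha> (lambda_bar A X R)"

definition behavioural_conformance ::
  "'a set \<Rightarrow> 'x set \<Rightarrow> ('a, 'x, 'k::field) wstruct \<Rightarrow> ('x \<Rightarrow> 'k) rel" where
  "behavioural_conformance A X \<alpha> = (GREATEST R. is_conformance A X \<alpha> R)"

text \<open>
  Identities, composition and the morphism part of a functor take the objects involved as
  arguments, so that a raw morphism may belong to several hom-sets.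
  \<open>Comp C a b c g f\<close> is the composite of \<open>f : a \<rightarrow> b\<close> and \<open>g : b \<rightarrow> c\<close>.
\<close>

record ('o, 'm) cat =
  Obj :: "'o set"
  Hom :: "'o \<Rightarrow> 'o \<Rightarrow> 'm set"
  Id :: "'o \<Rightarrow> 'm"
  Comp :: "'o \<Rightarrow> 'o \<Rightarrow> 'o \<Rightarrow> 'm \<Rightarrow> 'm \<Rightarrow> 'm"

definition is_category :: "('o, 'm) cat \<Rightarrow> bool" where
  "is_category C \<longleftrightarrow>
     (\<forall>a\<in>Obj C. Id C a \<in> Hom C a a) \<and>
     (\<forall>a\<in>Obj C. \<forall>b\<in>Obj C. \<forall>c\<in>Obj C. \<forall>f\<in>Hom C a b. \<forall>g\<in>Hom C b c.
        Comp C a b c g f \<in> Hom C a c) \<and>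
     (\<forall>a\<in>Obj C. \<forall>b\<in>Obj C. \<forall>f\<in>Hom C a b.
        Comp C a a b f (Id C a) = f \<and> Comp C a b b (Id C b) f = f) \<and>
     (\<forall>a\<in>Obj C. \<forall>b\<in>Obj C. \<forall>c\<in>Obj C. \<forall>d\<in>Obj C.
        \<forall>f\<in>Hom C a b. \<forall>g\<in>Hom C b c. \<forall>h\<in>Hom C c d.
        Comp C a c d h (Comp C a b c g f) = Comp C a b d (Comp C b c d h g) f)"

definition is_functor ::
  "('o, 'm) cat \<Rightarrow> ('p, 'n) cat \<Rightarrow> ('o \<Rightarrow> 'p) \<Rightarrow> ('o \<Rightarrow> 'o \<Rightarrow> 'm \<Rightarrow> 'n) \<Rightarrow> bool" where
  "is_functor C D T t \<longleftrightarrow>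
     is_category C \<and> is_category D \<and>
     (\<forall>a\<in>Obj C. T a \<in> Obj D) \<and>
     (\<forall>a\<in>Obj C. \<forall>b\<in>Obj C. \<forall>f\<in>Hom C a b. t a b f \<in> Hom D (T a) (T b)) \<and>
     (\<forall>a\<in>Obj C. t a a (Id C a) = Id D (T a)) \<and>
     (\<forall>a\<in>Obj C. \<forall>b\<in>Obj C. \<forall>c\<in>Obj C. \<forall>f\<in>Hom C a b. \<forall>g\<in>Hom C b c.
        t a c (Comp C a b c g f) = Comp D (T a) (T b) (T c) (t b c g) (t a b f))"

text \<open>Here the type \<open>'u\<close> is the universe from which the carriers are taken.\<close>

type_synonym ('a, 'u, 'k) coalg = "'u set \<times> ('a, 'u, 'k) wstruct"

definition coalg_cat ::
  "'a set \<Rightarrow> (('a, 'u, 'k::field) coalg, 'u \<Rightarrow> 'u \<Rightarrow> 'k) cat" where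
  "coalg_cat A =
     \<lparr> Obj = {(X, \<alpha>). coalgebra A X \<alpha>},
       Hom = (\<lambda>(X, \<alpha>) (Y, \<beta>). {f. coalg_hom A X \<alpha> Y \<beta> f}),
       Id = (\<lambda>(X, \<alpha>). kl_id X),
       Comp = (\<lambda>(X, \<alpha>) _ _ g f. kl_comp X g f) \<rparr>"

definition coalg_rel_cat ::
  "'a set \<Rightarrow> (('a, 'u, 'k::field) coalg \<times> ('u \<Rightarrow> 'k) rel, 'u \<Rightarrow> 'u \<Rightarrow> 'k) cat" where
  "coalg_rel_cat A =
     \<lparr> Obj = {((X, \<alpha>), R). coalgebra A X \<alpha> \<and> R \<subseteq> Mset X \<times> Mset X},
       Hom = (\<lambda>((X, \<alpha>), R) ((Y, \<beta>), S). {f. coalg_hom A X \<alpha> Y \<beta> f \<and> R \<subseteq> reindex X f S}),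
       Id = (\<lambda>((X, \<alpha>), R). kl_id X),
       Comp = (\<lambda>((X, \<alpha>), R) _ _ g f. kl_comp X g f) \<rparr>"

definition conformance_functor_obj ::
  "'a set \<Rightarrow> ('a, 'u, 'k::field) coalg \<Rightarrow> ('a, 'u, 'k) coalg \<times> ('u \<Rightarrow> 'k) rel" where
  "conformance_functor_obj A = (\<lambda>(X, \<alpha>). ((X, \<alpha>), behavioural_conformance A X \<alpha>))"

end

theory Submission
  imports Defs
begin

text \<open>
  The letter transitions and the output of the determinisation are the components of \<open>|\<alpha>|\<close>:
  \<open>p\<^sub>a = \<gamma>(|\<alpha>|(p))(a)\<close> and \<open>o(p) = |\<alpha>|(p)(\<bullet>)\<close>.  Hence a relation is a conformance iff related
  vectors have equal outputs and related successors, so language equivalence is the greatest one.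
  Since \<open>|F_bar f|\<close> preserves the \<open>\<bullet>\<close>-component and acts as \<open>|f|\<close> on each letter component,
  a homomorphism \<open>f\<close> satisfies \<open>|f|(p\<^sub>a) = |f|(p)\<^sub>a\<close> and \<open>o(|f|(p)) = o(p)\<close>; thus \<open>|f|\<close>
  preserves the language of every vector.
\<close>

section \<open>Linear extension and the Kleisli category of the multiset monad\<close>

lemma MsetD: "p \<in> Mset X \<Longrightarrow> finite (supp p)" "p \<in> Mset X \<Longrightarrow> supp p \<subseteq> X"
  by (auto simp: Mset_def)

lemma kl_homD: "f \<in> kl_hom X Y \<Longrightarrow> x \<in> X \<Longrightarrow> f x \<in> Mset Y"
  by (auto simp: kl_hom_def)

text \<open>Terms outside the support vanish. Moving to a larger finite index set lets vectors with
  different supports be summed over one common set.\<close>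

lemma kl_ext_eq_sum:
  assumes "finite S" "supp p \<subseteq> S"
  shows "kl_ext f p y = (\<Sum>x\<in>S. p x * f x y)"
  unfolding kl_ext_def using assms by (intro sum.mono_neutral_left) (auto simp: supp_def)

text \<open>A nonzero coordinate of the sum needs a nonzero summand, so the support lies in a finite
  union of the finite supports of the \<open>f x\<close>.\<close>

lemma kl_ext_in_Mset:
  assumes p: "p \<in> Mset X" and f: "f \<in> kl_hom X Y"
  shows "kl_ext f p \<in> Mset Y"
proof -
  have "supp (kl_ext f p) \<subseteq> (\<Union>x\<in>supp p. supp (f x))"
  proof
    fix y assume "y \<in> supp (kl_ext f p)"
    then have "(\<Sum>x\<in>supp p. p x * f x y) \<noteq> 0" by (simp add: supp_def kl_ext_def)
    then obtain x where "x \<in> supp p" "p x * f x y \<noteq> 0" by (rule sum.not_neutral_contains_not_neutral)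
    then show "y \<in> (\<Union>x\<in>supp p. supp (f x))" by (auto simp: supp_def)
  qed
  moreover have "f x \<in> Mset Y" if "x \<in> supp p" for x
    using MsetD(2)[OF p] f that by (auto intro: kl_homD)
  then have "finite (\<Union>x\<in>supp p. supp (f x))" "(\<Union>x\<in>supp p. supp (f x)) \<subseteq> Y"
    using MsetD(1)[OF p] by (auto dest: MsetD)
  ultimately show ?thesis unfolding Mset_def by (blast intro: finite_subset)
qed

text \<open>Exchanging two finite sums shows that linear extension turns Kleisli composition into
  composition of maps; the laws for composites rest on this.\<close>

lemma kl_ext_kl_ext:
  assumes p: "p \<in> Mset X" and f: "f \<in> kl_hom X Y"
  shows "kl_ext g (kl_ext f p) = kl_ext (kl_comp X g f) p"
proof
  fix z
  \<comment> \<open>One index set, independent of \<open>x\<close>, that contains the support of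
    every \<open>f x\<close> and also that of \<open>kl_ext f p\<close>, where cancellation may
    occur.\<close>
  let ?S = "\<Union>x\<in>supp p. supp (f x)"
  have fx: "f x \<in> Mset Y" "x \<in> X" if "x \<in> supp p" for x
    using MsetD(2)[OF p] f that by (auto intro: kl_homD)
  have fin: "finite ?S" using MsetD(1)[OF p] fx by (auto dest: MsetD)
  have "y \<in> ?S" if "y \<in> supp (kl_ext f p)" for y
  proof (rule ccontr)
    assume "y \<notin> ?S"
    then have "kl_ext f p y = 0" by (auto simp: kl_ext_def supp_def intro!: sum.neutral)
    then show False using that by (simp add: supp_def)
  qed
  then have "kl_ext g (kl_ext f p) z = (\<Sum>y\<in>?S. kl_ext f p y * g y z)"
    by (intro kl_ext_eq_sum[OF fin]) auto
  also have "\<dots> = (\<Sum>y\<in>?S. \<Sum>x\<in>supp p. p x * (f x y * g y z))"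
    by (simp add: kl_ext_def sum_distrib_right mult.assoc)
  also have "\<dots> = (\<Sum>x\<in>supp p. p x * (\<Sum>y\<in>?S. f x y * g y z))"
    by (subst sum.swap) (simp add: sum_distrib_left)
  also have "\<dots> = (\<Sum>x\<in>supp p. p x * kl_comp X g f x z)"
  proof (rule sum.cong[OF refl])
    fix x assume x: "x \<in> supp p"
    then have "kl_ext g (f x) z = (\<Sum>y\<in>?S. f x y * g y z)"
      by (intro kl_ext_eq_sum[OF fin]) auto
    then show "p x * (\<Sum>y\<in>?S. f x y * g y z) = p x * kl_comp X g f x z"
      using fx(2)[OF x] by (simp add: kl_comp_def)
  qed
  finally show "kl_ext g (kl_ext f p) z = kl_ext (kl_comp X g f) p z"
    by (simp add: kl_ext_def)
qed

lemma supp_dirac: "supp (dirac x) = {x}"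
  by (auto simp: supp_def dirac_def)

lemma kl_ext_dirac: "kl_ext f (dirac x) = f x"
  by (simp add: kl_ext_def supp_dirac) (simp add: dirac_def)

lemma kl_ext_id:
  assumes "p \<in> Mset X"
  shows "kl_ext (kl_id X) p = p"
proof
  fix y
  have "kl_ext (kl_id X) p y = (\<Sum>x\<in>supp p. if x = y then p x else 0)"
    unfolding kl_ext_def using MsetD(2)[OF assms]
    by (intro sum.cong) (auto simp: kl_id_def dirac_def)
  also have "\<dots> = p y" using MsetD(1)[OF assms] by (simp add: supp_def)
  finally show "kl_ext (kl_id X) p y = p y" .
qed

lemma kl_id_in_kl_hom: "kl_id X \<in> kl_hom X X"
  by (auto simp: kl_id_def kl_hom_def Mset_def supp_def dirac_def)

lemma kl_comp_in_kl_hom: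
  "f \<in> kl_hom X Y \<Longrightarrow> g \<in> kl_hom Y Z \<Longrightarrow> kl_comp X g f \<in> kl_hom X Z"
  unfolding kl_comp_def by (auto simp: kl_hom_def[of X Z] intro: kl_ext_in_Mset kl_homD)

lemma kl_comp_id_right: "f \<in> kl_hom X Y \<Longrightarrow> kl_comp X f (kl_id X) = f"
  by (rule extensionalityI[of _ X])
    (auto simp: kl_comp_def kl_hom_def kl_id_def kl_ext_dirac PiE_def)

lemma kl_comp_id_left: "f \<in> kl_hom X Y \<Longrightarrow> kl_comp X (kl_id Y) f = f"
  by (rule extensionalityI[of _ X])
    (auto simp: kl_comp_def kl_hom_def PiE_def intro!: kl_ext_id)

lemma kl_comp_assoc:
  "f \<in> kl_hom X Y \<Longrightarrow> g \<in> kl_hom Y Z \<Longrightarrow>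
    kl_comp X h (kl_comp X g f) = kl_comp X (kl_comp Y h g) f"
  by (auto simp: kl_comp_def[of X] fun_eq_iff restrict_def kl_ext_kl_ext[OF kl_homD])

section \<open>The lifted functor acting on vectors\<close>

text \<open>Splits a vector into its output and its letter blocks, so that identities about
  \<open>F_bar\<close> reduce to identities about \<open>kl_ext\<close> on each block.\<close>

lemma F_vector_eqI:
  "q bullet = q' bullet \<Longrightarrow> (\<And>a. gamma q a = gamma q' a) \<Longrightarrow> q = q'"
  by (rule ext, rename_tac z, case_tac z) (auto simp: gamma_def fun_eq_iff)

text \<open>The injection of \<open>x\<close> as \<open>Inl (a, x)\<close> embeds the support of the
  block into the finite support of \<open>q\<close>.\<close>

lemma gamma_in_Mset:
  assumes "q \<in> Mset (F_obj A X)"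
  shows "gamma q a \<in> Mset X"
proof -
  have "(\<lambda>x. Inl (a, x)) ` supp (gamma q a) \<subseteq> supp q" by (auto simp: supp_def gamma_def)
  then have "finite (supp (gamma q a))"
    using MsetD(1)[OF assms] by (rule inj_on_finite[rotated]) (auto simp: inj_on_def)
  moreover have "supp (gamma q a) \<subseteq> X"
    using MsetD(2)[OF assms] by (auto simp: supp_def gamma_def F_obj_def)
  ultimately show ?thesis by (simp add: Mset_def)
qed

lemma F_bar_in_kl_hom:
  assumes f: "f \<in> kl_hom X Y"
  shows "F_bar A X f \<in> kl_hom (F_obj A X) (F_obj A Y)"
proof -
  have "distr_law (F_map f z) \<in> Mset (F_obj A Y)" if "z \<in> F_obj A X" for z
  proof (cases z)
    case (Inl ax)
    then obtain a x where z: "z = Inl (a, x)" "a \<in> A" "x \<in> X"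
      using \<open>z \<in> F_obj A X\<close> by (auto simp: F_obj_def)
    have "v \<in> (\<lambda>y. Inl (a, y)) ` supp (f x)" if "v \<in> supp (distr_law (F_map f z))" for v
      using that by (cases v) (auto simp: z(1) F_map_def supp_def split: if_splits)
    then have "supp (distr_law (F_map f z)) \<subseteq> (\<lambda>y. Inl (a, y)) ` supp (f x)" by blast
    moreover have "(\<lambda>y. Inl (a, y)) ` supp (f x) \<subseteq> F_obj A Y"
      using z(2) MsetD(2)[OF kl_homD[OF f z(3)]] by (auto simp: F_obj_def)
    moreover have "finite ((\<lambda>y. Inl (a, y)) ` supp (f x))"
      using MsetD(1)[OF kl_homD[OF f z(3)]] by simp
    ultimately show ?thesis unfolding Mset_def by (blast intro: finite_subset)
  next
    case (Inr u)
    then show ?thesis by (auto simp: F_map_def Mset_def supp_def dirac_def F_obj_def)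
  qed
  then show ?thesis by (auto simp: F_bar_def kl_hom_def)
qed

text \<open>Among the basis elements only \<open>bullet\<close> has an image with a nonzero
  \<open>bullet\<close> coordinate, and there it is 1.\<close>

lemma kl_ext_F_bar_bullet:
  assumes q: "q \<in> Mset (F_obj A X)"
  shows "kl_ext (F_bar A X f) q bullet = q bullet"
proof -
  have "kl_ext (F_bar A X f) q bullet = (\<Sum>z\<in>supp q. if z = bullet then q z else 0)"
    unfolding kl_ext_def using MsetD(2)[OF q]
    by (intro sum.cong) (auto simp: F_bar_def F_map_def F_obj_def dirac_def)
  also have "\<dots> = q bullet" using MsetD(1)[OF q] by (simp add: supp_def)
  finally show ?thesis .
qed

text \<open>The distributive law keeps the letter, so the extension of \<open>F_bar\<close> is block
  diagonal. For \<open>a\<close> outside \<open>A\<close> both sides are zero, because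
  \<open>q\<close> is supported in \<open>F_obj A X\<close>.\<close>

lemma gamma_kl_ext_F_bar:
  assumes q: "q \<in> Mset (F_obj A X)"
  shows "gamma (kl_ext (F_bar A X f) q) a = kl_ext f (gamma q a)"
proof
  fix y
  let ?i = "\<lambda>x. Inl (a, x)"
  have "gamma (kl_ext (F_bar A X f) q) a y = (\<Sum>z\<in>supp q. q z * F_bar A X f z (Inl (a, y)))"
    by (simp add: gamma_def kl_ext_def)
  also have "\<dots> = (\<Sum>z\<in>?i ` supp (gamma q a). q z * F_bar A X f z (Inl (a, y)))"
  proof (rule sum.mono_neutral_right)
    \<comment> \<open>What remains of the support is \<open>bullet\<close> or carries another
      letter; both have images that vanish at \<open>Inl (a, y)\<close>.\<close>
    show "\<forall>z\<in>supp q - ?i ` supp (gamma q a). q z * F_bar A X f z (Inl (a, y)) = 0"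
      using MsetD(2)[OF q]
      by (auto simp: F_bar_def F_map_def F_obj_def dirac_def supp_def gamma_def image_iff)
  qed (use MsetD(1)[OF q] in \<open>auto simp: supp_def gamma_def\<close>)
  also have "\<dots> = (\<Sum>x\<in>supp (gamma q a). gamma q a x * F_bar A X f (?i x) (Inl (a, y)))"
    by (subst sum.reindex) (auto simp: inj_on_def gamma_def)
  also have "\<dots> = (\<Sum>x\<in>supp (gamma q a). gamma q a x * f x y)"
  proof (rule sum.cong[OF refl])
    fix x assume "x \<in> supp (gamma q a)"
    then have "?i x \<in> F_obj A X" using MsetD(2)[OF q] by (auto simp: supp_def gamma_def)
    then show "gamma q a x * F_bar A X f (?i x) (Inl (a, y)) = gamma q a x * f x y"
      by (simp add: F_bar_def F_map_def)
  qed
  finally show "gamma (kl_ext (F_bar A X f) q) a y = kl_ext f (gamma q a) y"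
    by (simp add: kl_ext_def)
qed

text \<open>With \<open>kl_ext_F_bar_comp\<close>, this is functoriality of the lifting, evaluated
  on vectors because it is applied to the values of a coalgebra structure.\<close>

lemma kl_ext_F_bar_id:
  "q \<in> Mset (F_obj A X) \<Longrightarrow> kl_ext (F_bar A X (kl_id X)) q = q"
  by (rule F_vector_eqI)
    (simp_all add: kl_ext_F_bar_bullet gamma_kl_ext_F_bar kl_ext_id[OF gamma_in_Mset])

lemma kl_ext_F_bar_comp:
  assumes "q \<in> Mset (F_obj A X)" "f \<in> kl_hom X Y"
  shows "kl_ext (F_bar A X (kl_comp X g f)) q = kl_ext (F_bar A Y g) (kl_ext (F_bar A X f) q)"
proof -
  have "kl_ext (F_bar A X f) q \<in> Mset (F_obj A Y)"
    by (rule kl_ext_in_Mset[OF assms(1) F_bar_in_kl_hom[OF assms(2)]])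
  then show ?thesis using assms
    by (intro F_vector_eqI)
      (simp_all add: kl_ext_F_bar_bullet gamma_kl_ext_F_bar kl_ext_kl_ext[OF gamma_in_Mset])
qed

section \<open>Identities and composites of coalgebra homomorphisms\<close>

lemma coalg_hom_id:
  assumes "coalgebra A X \<alpha>"
  shows "coalg_hom A X \<alpha> X \<alpha> (kl_id X)"
proof -
  have \<alpha>: "\<alpha> \<in> kl_hom X (F_obj A X)" using assms by (simp add: coalgebra_def)
  have "kl_comp X (F_bar A X (kl_id X)) \<alpha> = \<alpha>"
    using \<alpha> by (intro extensionalityI[of _ X])
      (auto simp: kl_comp_def kl_hom_def PiE_def intro!: kl_ext_F_bar_id)
  then show ?thesis
    using \<alpha> by (simp add: coalg_hom_def kl_id_in_kl_hom kl_comp_id_right)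
qed

text \<open>The two homomorphism squares are pasted along \<beta>, using functoriality of
  \<open>F_bar\<close> and associativity in the Kleisli category.\<close>

lemma coalg_hom_comp:
  assumes "coalgebra A X \<alpha>" "coalgebra A Y \<beta>"
    and f: "coalg_hom A X \<alpha> Y \<beta> f" and g: "coalg_hom A Y \<beta> Z \<zeta> g"
  shows "coalg_hom A X \<alpha> Z \<zeta> (kl_comp X g f)"
proof -
  have \<alpha>: "\<alpha> \<in> kl_hom X (F_obj A X)" and \<beta>: "\<beta> \<in> kl_hom Y (F_obj A Y)"
    using assms by (simp_all add: coalgebra_def)
  have f': "f \<in> kl_hom X Y" and g': "g \<in> kl_hom Y Z"
    using f g by (simp_all add: coalg_hom_def)
  have "kl_comp X (F_bar A X (kl_comp X g f)) \<alpha>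
      = kl_comp X (F_bar A Y g) (kl_comp X (F_bar A X f) \<alpha>)"
    using \<alpha> f' by (auto simp: kl_comp_def[of X _ \<alpha>] kl_comp_def[of X "F_bar A Y g"] restrict_def
        fun_eq_iff kl_ext_F_bar_comp[OF kl_homD])
  also have "\<dots> = kl_comp X (F_bar A Y g) (kl_comp X \<beta> f)"
    using f by (simp add: coalg_hom_def)
  also have "\<dots> = kl_comp X (kl_comp Y (F_bar A Y g) \<beta>) f"
    using f' \<beta> by (rule kl_comp_assoc)
  also have "\<dots> = kl_comp X (kl_comp Y \<zeta> g) f"
    using g by (simp add: coalg_hom_def)
  also have "\<dots> = kl_comp X \<zeta> (kl_comp X g f)"
    by (rule kl_comp_assoc[OF f' g', symmetric])
  finally show ?thesis using f' g' by (simp add: coalg_hom_def kl_comp_in_kl_hom)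
qed

section \<open>The determinised automaton and its behaviour under homomorphisms\<close>

lemma det_step_eq_gamma: "det_step \<alpha> p a = gamma (kl_ext \<alpha> p) a"
  by (simp add: det_step_def gamma_def kl_ext_def)

lemma det_out_eq_bullet: "det_out \<alpha> p = kl_ext \<alpha> p bullet"
  by (simp add: det_out_def kl_ext_def)

lemma kl_ext_coalgebra_in_Mset:
  "coalgebra A X \<alpha> \<Longrightarrow> p \<in> Mset X \<Longrightarrow> kl_ext \<alpha> p \<in> Mset (F_obj A X)"
  by (auto simp: coalgebra_def intro: kl_ext_in_Mset)

lemma det_step_in_Mset: "coalgebra A X \<alpha> \<Longrightarrow> p \<in> Mset X \<Longrightarrow> det_step \<alpha> p a \<in> Mset X"
  unfolding det_step_eq_gamma by (intro gamma_in_Mset kl_ext_coalgebra_in_Mset)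

text \<open>The homomorphism square relates values at single states; linear extension carries it to
  all vectors. Its letter blocks and its \<open>bullet\<close> coordinate give the next two
  lemmas.\<close>

lemma kl_ext_coalg_hom:
  assumes "coalgebra A X \<alpha>" "coalg_hom A X \<alpha> Y \<beta> f" "p \<in> Mset X"
  shows "kl_ext \<beta> (kl_ext f p) = kl_ext (F_bar A X f) (kl_ext \<alpha> p)"
proof -
  have "f \<in> kl_hom X Y" "\<alpha> \<in> kl_hom X (F_obj A X)"
    and "kl_comp X (F_bar A X f) \<alpha> = kl_comp X \<beta> f"
    using assms by (auto simp: coalg_hom_def coalgebra_def)
  then show ?thesis using assms(3) by (simp add: kl_ext_kl_ext)
qed

lemma kl_ext_det_step:
  assumes "coalgebra A X \<alpha>" "coalg_hom A X \<alpha> Y \<beta> f" "p \<in> Mset X"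
  shows "kl_ext f (det_step \<alpha> p a) = det_step \<beta> (kl_ext f p) a"
  using assms
  by (simp add: det_step_eq_gamma kl_ext_coalg_hom gamma_kl_ext_F_bar kl_ext_coalgebra_in_Mset)

lemma det_out_kl_ext:
  assumes "coalgebra A X \<alpha>" "coalg_hom A X \<alpha> Y \<beta> f" "p \<in> Mset X"
  shows "det_out \<beta> (kl_ext f p) = det_out \<alpha> p"
  using assms
  by (simp add: det_out_eq_bullet kl_ext_coalg_hom kl_ext_F_bar_bullet kl_ext_coalgebra_in_Mset)

lemma coalg_hom_preserves_language:
  assumes "coalgebra A X \<alpha>" "coalg_hom A X \<alpha> Y \<beta> f" "p \<in> Mset X"
  shows "det_out \<beta> (det_word \<beta> (kl_ext f p) w) = det_out \<alpha> (det_word \<alpha> p w)"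
  using assms(3)
\<comment> \<open>The vector is generalised because reading a letter replaces it by its
  successor.\<close>
proof (induction w arbitrary: p)
  case Nil
  then show ?case using assms by (simp add: det_out_kl_ext)
next
  case (Cons a w)
  have "det_step \<beta> (kl_ext f p) a = kl_ext f (det_step \<alpha> p a)"
    using kl_ext_det_step[OF assms(1,2) Cons.prems] by simp
  then show ?case using Cons.IH[OF det_step_in_Mset[OF assms(1) Cons.prems]] by simp
qed

lemma lang_equiv_reindex:
  assumes "coalgebra A X \<alpha>" "coalg_hom A X \<alpha> Y \<beta> f"
  shows "lang_equiv A X \<alpha> = reindex X f (lang_equiv A Y \<beta>)"
proof -
  have "f \<in> kl_hom X Y" using assms by (simp add: coalg_hom_def)
  then show ?thesis
    using coalg_hom_preserves_language[OF assms]
    \<comment> \<open>Language equivalence on \<open>Y\<close> also demands membership in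
      \<open>Mset Y\<close>, which \<open>kl_ext_in_Mset\<close> supplies for the images.\<close>
    by (intro set_eqI, clarsimp simp: lang_equiv_def reindex_def) (metis kl_ext_in_Mset)
qed

section \<open>Language equivalence as the greatest conformance\<close>

text \<open>Reading \<alpha> through its output and letter blocks turns conformances into
  bisimulations on the determinised automaton.\<close>

lemma is_conformance_iff:
  assumes "coalgebra A X \<alpha>"
  shows "is_conformance A X \<alpha> R \<longleftrightarrow> R \<subseteq> Mset X \<times> Mset X \<and>
    (\<forall>(p, p')\<in>R. det_out \<alpha> p = det_out \<alpha> p' \<and>
      (\<forall>a\<in>A. (det_step \<alpha> p a, det_step \<alpha> p' a) \<in> R))"
proof -
  have "(p, p') \<in> reindex X \<alpha> (lambda_bar A X R) \<longleftrightarrow> det_out \<alpha> p = det_out \<alpha> p' \<and>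
      (\<forall>a\<in>A. (det_step \<alpha> p a, det_step \<alpha> p' a) \<in> R)"
    if "p \<in> Mset X" "p' \<in> Mset X" for p p'
    using that kl_ext_coalgebra_in_Mset[OF assms]
    by (simp add: reindex_def lambda_bar_def det_out_eq_bullet det_step_eq_gamma)
  then show ?thesis unfolding is_conformance_def by fast
qed

lemma is_conformance_lang_equiv:
  assumes "coalgebra A X \<alpha>"
  shows "is_conformance A X \<alpha> (lang_equiv A X \<alpha>)"
proof -
  have "det_out \<alpha> p = det_out \<alpha> p' \<and> (\<forall>a\<in>A. (det_step \<alpha> p a, det_step \<alpha> p' a) \<in> lang_equiv A X \<alpha>)"
    if "(p, p') \<in> lang_equiv A X \<alpha>" for p p'
  proof -
    have p: "p \<in> Mset X" "p' \<in> Mset X"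
      and w: "\<And>w. w \<in> lists A \<Longrightarrow> det_out \<alpha> (det_word \<alpha> p w) = det_out \<alpha> (det_word \<alpha> p' w)"
      using that by (auto simp: lang_equiv_def)
    have "(det_step \<alpha> p a, det_step \<alpha> p' a) \<in> lang_equiv A X \<alpha>" if "a \<in> A" for a
      \<comment> \<open>Words starting with \<open>a\<close> give equivalence of the
        \<open>a\<close>-successors; the empty word below gives equality of outputs.\<close>
      using w[of "a # _"] that p by (auto simp: lang_equiv_def det_step_in_Mset[OF assms])
    with w[of "[]"] show ?thesis by simp
  qed
  moreover have "lang_equiv A X \<alpha> \<subseteq> Mset X \<times> Mset X" by (auto simp: lang_equiv_def)
  ultimately show ?thesis unfolding is_conformance_iff[OF assms] by blast
qed

text \<open>Coinduction: reading a word over \<open>A\<close> letter by letter stays inside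
  \<open>R\<close>, where outputs agree.\<close>

lemma is_conformance_imp_subset_lang_equiv:
  assumes \<alpha>: "coalgebra A X \<alpha>" and R: "is_conformance A X \<alpha> R"
  shows "R \<subseteq> lang_equiv A X \<alpha>"
proof -
  have "det_out \<alpha> (det_word \<alpha> p w) = det_out \<alpha> (det_word \<alpha> p' w)"
    if "(p, p') \<in> R" "w \<in> lists A" for p p' w
    \<comment> \<open>The word fact comes first so that the rule \<open>lists.induct\<close>
      consumes it, and membership in \<open>R\<close> becomes a premise for varying vectors.\<close>
    using that(2,1)
  proof (induction w arbitrary: p p' rule: lists.induct)
    case Nil
    then show ?case using R unfolding is_conformance_iff[OF \<alpha>] by auto
  next
    case (Cons a w)
    then have "(det_step \<alpha> p a, det_step \<alpha> p' a) \<in> R"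
      using R unfolding is_conformance_iff[OF \<alpha>] by auto
    then show ?case using Cons.IH by simp
  qed
  then show ?thesis using R by (auto simp: lang_equiv_def is_conformance_def)
qed

text \<open>The operator \<open>GREATEST\<close> is determined here because language equivalence is
  itself a conformance and contains every other one.\<close>

lemma behavioural_conformance_eq_lang_equiv:
  "coalgebra A X \<alpha> \<Longrightarrow> behavioural_conformance A X \<alpha> = lang_equiv A X \<alpha>"
  unfolding behavioural_conformance_def
  by (intro Greatest_equality is_conformance_lang_equiv is_conformance_imp_subset_lang_equiv)

section \<open>Reindexing of relations and the conformance functor\<close>

lemma reindex_id: "R \<subseteq> Mset X \<times> Mset X \<Longrightarrow> reindex X (kl_id X) R = R"
  by (auto simp: reindex_def kl_ext_id)

text \<open>Since the extension of \<open>f\<close> maps \<open>Mset X\<close> into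
  \<open>Mset Y\<close>, the domain restriction built into the inner \<open>reindex\<close> removes
  no pair.\<close>

lemma reindex_comp:
  "f \<in> kl_hom X Y \<Longrightarrow> reindex X (kl_comp X g f) R = reindex X f (reindex Y g R)"
  by (auto simp: reindex_def kl_ext_kl_ext kl_ext_in_Mset)

lemma reindex_mono: "R \<subseteq> S \<Longrightarrow> reindex X f R \<subseteq> reindex X f S"
  by (auto simp: reindex_def)

lemma coalg_hom_in_kl_hom: "coalg_hom A X \<alpha> Y \<beta> f \<Longrightarrow> f \<in> kl_hom X Y"
  by (simp add: coalg_hom_def)

lemma is_category_coalg_cat:
  "is_category (coalg_cat A :: (('a, 'u, 'k::field) coalg, 'u \<Rightarrow> 'u \<Rightarrow> 'k) cat)"
  unfolding is_category_def coalg_cat_def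
  apply (intro conjI ballI)
  subgoal by (clarsimp simp: coalg_hom_id)
  subgoal by (clarsimp, rule coalg_hom_comp)
  subgoal by (clarsimp, rule kl_comp_id_right, erule coalg_hom_in_kl_hom)
  subgoal by (clarsimp, rule kl_comp_id_left, erule coalg_hom_in_kl_hom)
  subgoal by (clarsimp, rule kl_comp_assoc; erule coalg_hom_in_kl_hom)
  done

lemma subset_reindex_comp:
  assumes "f \<in> kl_hom X Y" "R \<subseteq> reindex X f S" "S \<subseteq> reindex Y g T"
  shows "R \<subseteq> reindex X (kl_comp X g f) T"
  using assms(2) reindex_mono[OF assms(3), of X f] by (simp add: reindex_comp[OF assms(1)])

text \<open>The laws come from the Kleisli category as for \<open>coalg_cat\<close>; the additional
  content is that \<open>reindex_id\<close> and \<open>subset_reindex_comp\<close> keep the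
  relational condition.\<close>

lemma is_category_coalg_rel_cat:
  "is_category (coalg_rel_cat A ::
    (('a, 'u, 'k::field) coalg \<times> ('u \<Rightarrow> 'k) rel, 'u \<Rightarrow> 'u \<Rightarrow> 'k) cat)"
  unfolding is_category_def coalg_rel_cat_def
  apply (intro conjI ballI)
  subgoal by (clarsimp simp: coalg_hom_id reindex_id)
  subgoal
    by (clarsimp, intro conjI, (rule coalg_hom_comp; assumption),
        rule subset_reindex_comp[OF coalg_hom_in_kl_hom])
  subgoal by (clarsimp, rule kl_comp_id_right, erule coalg_hom_in_kl_hom)
  subgoal by (clarsimp, rule kl_comp_id_left, erule coalg_hom_in_kl_hom)
  subgoal by (clarsimp, rule kl_comp_assoc; erule coalg_hom_in_kl_hom)
  done

lemma conformance_functor_obj_eq: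
  "coalgebra A X \<alpha> \<Longrightarrow> conformance_functor_obj A (X, \<alpha>) = ((X, \<alpha>), lang_equiv A X \<alpha>)"
  by (simp add: conformance_functor_obj_def behavioural_conformance_eq_lang_equiv)

text \<open>Morphisms are left unchanged, so what remains is that language equivalence is a relation
  on \<open>Mset X\<close> and that every homomorphism preserves it, which is one inclusion of
  \<open>lang_equiv_reindex\<close>.\<close>

lemma is_functor_conformance:
  "is_functor (coalg_cat A :: (('a, 'u, 'k::field) coalg, 'u \<Rightarrow> 'u \<Rightarrow> 'k) cat)
    (coalg_rel_cat A) (conformance_functor_obj A) (\<lambda>_ _ f. f)"
  unfolding is_functor_def
  apply (intro conjI ballI is_category_coalg_cat is_category_coalg_rel_cat;
      clarsimp simp: coalg_cat_def coalg_rel_cat_def conformance_functor_obj_eq)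
  subgoal by (auto simp: lang_equiv_def)
  subgoal by (drule (1) lang_equiv_reindex) simp
  done

theorem theorem10:
  fixes A :: "'a set" and X :: "'x set" and \<alpha> :: "('a, 'x, 'k::field) wstruct"
  assumes "coalgebra A X \<alpha>"
  shows "lang_equiv A X \<alpha> \<subseteq> reindex X \<alpha> (lambda_bar A X (lang_equiv A X \<alpha>))
    \<and> (\<forall>(Y :: 'y set) \<beta> f. coalgebra A Y \<beta> \<longrightarrow> coalg_hom A X \<alpha> Y \<beta> f \<longrightarrow>
          lang_equiv A X \<alpha> = reindex X f (lang_equiv A Y \<beta>))
    \<and> is_conformance A X \<alpha> (behavioural_conformance A X \<alpha>)
    \<and> (\<forall>R. is_conformance A X \<alpha> R \<longrightarrow> R \<subseteq> behavioural_conformance A X \<alpha>)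
    \<and> is_functor
        (coalg_cat A :: (('a, 'u, 'k) coalg, 'u \<Rightarrow> 'u \<Rightarrow> 'k) cat)
        (coalg_rel_cat A)
        (conformance_functor_obj A) (\<lambda>_ _ f. f)"
proof (intro conjI allI impI)
  show "lang_equiv A X \<alpha> \<subseteq> reindex X \<alpha> (lambda_bar A X (lang_equiv A X \<alpha>))"
    using is_conformance_lang_equiv[OF assms] by (simp add: is_conformance_def)
  show "lang_equiv A X \<alpha> = reindex X f (lang_equiv A Y \<beta>)"
    if "coalg_hom A X \<alpha> Y \<beta> f" for Y :: "'y set" and \<beta> f
    using assms that by (rule lang_equiv_reindex)
  show "is_conformance A X \<alpha> (behavioural_conformance A X \<alpha>)"
    using assms by (simp add: behavioural_conformance_eq_lang_equiv is_conformance_lang_equiv)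
  show "R \<subseteq> behavioural_conformance A X \<alpha>" if "is_conformance A X \<alpha> R" for R
    using assms that
    by (simp add: behavioural_conformance_eq_lang_equiv is_conformance_imp_subset_lang_equiv)
qed (rule is_functor_conformance)

end
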